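(* The sets $$D_3=\left\{\frac{x_n}{x_{n-1}}:\ (x_1,\ldots,x_n)\in S_3(n),\ n\geq 3\right\}\quad\text{and}\quad D=\left\{\frac{x_n}{x_{n-1}}:\ (x_1,\ldots,x_n)\in S(n),\ n\geq 3\right\}$$ are dense in $[1,+\infty)$.
   Context: $\sigma_k$ denotes the $k$-th elementary symmetric polynomial in $n$ variables. $S(n)$ is the set of $n$-tuples $(x_1,\ldots,x_n)$ of positive integers with $x_1\leq\cdots\leq x_n$ and $\sigma_2(x_1,\ldots,x_n)=\sigma_n(x_1,\ldots,x_n)$; $S_3(n)$ is the subset of those with $x_1=\cdots=x_{n-3}=1$ and $2\leq x_{n-2}$. (The paper's definition of $D_3$ fixes no $n$; the union over all $n\geq 3$ is intended, as in $D$.) *)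

theory Defs
  imports "HOL-Analysis.Analysis"
begin

definition elem_sym :: "nat \<Rightarrow> nat \<Rightarrow> (nat \<Rightarrow> 'a::comm_semiring_1) \<Rightarrow> 'a" where
  "elem_sym k n x = (\<Sum>A | A \<subseteq> {1..n} \<and> card A = k. \<Prod>i\<in>A. x i)"

text \<open>An \<open>n\<close>-tuple \<open>(x\<^sub>1, \<dots>, x\<^sub>n)\<close> is a function extensional on the index set \<open>{1..n}\<close>.\<close>

definition S :: "nat \<Rightarrow> (nat \<Rightarrow> nat) set" where
  "S n = {x \<in> {1..n} \<rightarrow>\<^sub>E {1..}. mono_on {1..n} x \<and> elem_sym 2 n x = elem_sym n n x}"

text \<open>The truncated subtractions below are meant for \<open>n \<ge> 3\<close>, the only case used in \<open>D3\<close>.\<close>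

definition S3 :: "nat \<Rightarrow> (nat \<Rightarrow> nat) set" where
  "S3 n = {x \<in> S n. (\<forall>i\<in>{1..n - 3}. x i = 1) \<and> 2 \<le> x (n - 2)}"

definition D3 :: "real set" where
  "D3 = {real (x n) / real (x (n - 1)) | x n. 3 \<le> n \<and> x \<in> S3 n}"

definition D :: "real set" where
  "D = {real (x n) / real (x (n - 1)) | x n. 3 \<le> n \<and> x \<in> S n}"

definition dense_in :: "'a::topological_space set \<Rightarrow> 'a set \<Rightarrow> bool" where
  "dense_in A X \<longleftrightarrow> A \<subseteq> X \<and> X \<subseteq> closure A"

end

theory Submission
  imports Defs "HOL-Number_Theory.Cong"
begin

text \<open>
  The tuple \<open>(1, \<dots>, 1, 2, b, c)\<close> with \<open>m\<close> ones lies in \<open>S (m + 3)\<close> iff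
  \<open>(b - (m + 2)) (c - (m + 2)) = (m + 1) (3 m + 8) / 2\<close>. For \<open>m + 1 = 2 p t\<close> the right-hand side is
  \<open>p t (6 p t + 5)\<close>; if \<open>q\<close> is coprime to \<open>6 p\<close>, then \<open>q\<close> divides \<open>6 p t + 5\<close> for all \<open>t\<close> in a
  residue class, and the factorization \<open>(t q) (p (6 p t + 5) / q)\<close> yields ratios \<open>c / b\<close> tending to
  \<open>f (q / p)\<close> with \<open>f \<beta> = (6 + 2 \<beta>) / (\<beta> (\<beta> + 2))\<close> as \<open>t\<close> grows. The fractions \<open>q / p\<close> with
  \<open>p = 6 ^ k\<close> and \<open>q\<close> coprime to \<open>6\<close> are dense in \<open>(0, \<infinity>)\<close>, and \<open>f\<close> attains every value above \<open>1\<close>.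
\<close>

lemma elem_sym_0: "elem_sym 0 n x = 1"
proof -
  have "{A. A \<subseteq> {1..n} \<and> card A = 0} = {{}}"
    by (auto dest: finite_subset)
  then show ?thesis
    by (simp add: elem_sym_def)
qed

lemma elem_sym_self: "elem_sym n n x = (\<Prod>i\<in>{1..n}. x i)"
proof -
  have "{A. A \<subseteq> {1..n} \<and> card A = n} = {{1..n}}"
    by (auto dest: card_subset_eq[rotated])
  then show ?thesis
    by (simp add: elem_sym_def)
qed

text \<open>Subsets are split by whether they contain \<open>Suc n\<close>. The recurrence peels off
  the last three entries of a tuple, leaving a block of ones for
  \<open>elem_sym_ones\<close>.\<close>

lemma elem_sym_Suc_Suc:
  "elem_sym (Suc k) (Suc n) x = elem_sym (Suc k) n x + x (Suc n) * elem_sym k n x"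
proof -
  let ?P = "\<lambda>k n. {A. A \<subseteq> {1..n} \<and> card A = k}"
  have fin: "finite A" if "A \<subseteq> {1..n}" for A :: "nat set"
    using that finite_subset by blast
  have notin: "Suc n \<notin> A" if "A \<subseteq> {1..n}" for A
    using that by auto
  have "?P (Suc k) (Suc n) = ?P (Suc k) n \<union> insert (Suc n) ` ?P k n" (is "?L = ?R")
  proof
    show "?L \<subseteq> ?R"
    proof
      fix A assume A: "A \<in> ?L"
      show "A \<in> ?R"
      proof (cases "Suc n \<in> A")
        case True
        have "A - {Suc n} \<in> ?P k n" "A = insert (Suc n) (A - {Suc n})"
          using A True by (auto simp: atLeastAtMostSuc_conv)
        then show ?thesis by blast
      next
        case False
        then show ?thesis using A by (auto simp: atLeastAtMostSuc_conv)
      qed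
    qed
    show "?R \<subseteq> ?L"
      using fin notin by (auto simp: atLeastAtMostSuc_conv)
  qed
  moreover have "?P (Suc k) n \<inter> insert (Suc n) ` ?P k n = {}"
    by auto
  moreover have "inj_on (insert (Suc n)) (?P k n)"
    using notin by (auto simp: inj_on_def insert_ident)
  ultimately show ?thesis
    using fin notin
    by (simp add: elem_sym_def sum.union_disjoint sum.reindex sum_distrib_left)
qed

lemma elem_sym_ones:
  assumes "\<And>i. i \<in> {1..n} \<Longrightarrow> x i = 1"
  shows "elem_sym k n x = of_nat (n choose k)"
proof -
  have "elem_sym k n x = (\<Sum>A | A \<subseteq> {1..n} \<and> card A = k. 1)"
    unfolding elem_sym_def using assms by (intro sum.cong prod.neutral) auto
  then show ?thesis
    by (simp add: n_subsets)
qed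

text \<open>For \<open>m = 2 * P + 1\<close> ones, the number
  \<open>(m + 1) * (3 * m + 8) / 2\<close> equals \<open>(P + 1) * (6 * P + 11)\<close>, and
  \<open>m + 2 = 2 * P + 3\<close> is the shift from the factors \<open>u\<close>, \<open>v\<close>
  to the last two entries. The assumption \<open>u \<le> v\<close> keeps these in order.\<close>

lemma factorization_imp_D3:
  fixes u v P :: nat
  assumes uv: "u * v = (P + 1) * (6 * P + 11)" and "u \<le> v"
  shows "real (v + 2 * P + 3) / real (u + 2 * P + 3) \<in> D3"
proof -
  define m where "m = 2 * P + 1"
  define b where "b = u + 2 * P + 3"
  define c where "c = v + 2 * P + 3"
  \<comment> \<open>The value \<open>undefined\<close> outside the index set makes the tuple
    extensional, as \<open>S\<close> requires.\<close>
  define x where "x = (\<lambda>i. if i = 0 \<or> i > Suc (Suc (Suc m)) then undefined else if i \<le> m then 1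
     else if i = Suc m then 2 else if i = Suc (Suc m) then b else c)"
  have ones: "x i = 1" if "i \<in> {1..m}" for i
    using that by (auto simp: x_def)
  have xvals: "x (Suc m) = 2" "x (Suc (Suc m)) = b" "x (Suc (Suc (Suc m))) = c"
    by (auto simp: x_def)
  have "m choose 2 = P * (2 * P + 1)"
    by (simp add: choose_two m_def)
  then have "elem_sym 2 (Suc (Suc (Suc m))) x = P * (2 * P + 1) + m * (2 + b + c) + 2 * b + 2 * c + b * c"
    using elem_sym_ones[OF ones]
    by (simp add: elem_sym_Suc_Suc elem_sym_0 numeral_2_eq_2 xvals algebra_simps)
  also have "\<dots> = 2 * b * c"
    using uv unfolding m_def b_def c_def by (simp add: algebra_simps)
  also have "\<dots> = elem_sym (Suc (Suc (Suc m))) (Suc (Suc (Suc m))) x"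
    using ones by (simp add: elem_sym_self prod.nat_ivl_Suc' xvals)
  finally have "x \<in> S (Suc (Suc (Suc m)))"
    using \<open>u \<le> v\<close> by (auto simp: S_def mono_on_def x_def b_def c_def PiE_def extensional_def)
  then have "x \<in> S3 (Suc (Suc (Suc m)))"
    using ones xvals by (auto simp: S3_def)
  then have "real (x (Suc (Suc (Suc m)))) / real (x (Suc (Suc (Suc m)) - 1)) \<in> D3"
    unfolding D3_def by (intro CollectI exI[of _ x] exI[of _ "Suc (Suc (Suc m))"]) simp
  then show ?thesis
    by (simp add: xvals b_def c_def)
qed

text \<open>The limit is \<open>f (q / p)\<close> with numerator and denominator multiplied by
  \<open>p\<close>. It is reached by letting \<open>t\<close> grow in one residue class modulo
  \<open>q\<close>.\<close>

lemma limit_ratio_in_closure_D3: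
  fixes p q :: nat
  assumes "p > 0" "q > 0" and cop: "coprime (6 * p) q"
    and gt1: "(6 * real p ^ 2 / q + 2 * p) / (real q + 2 * p) > 1"
  shows "(6 * real p ^ 2 / q + 2 * p) / (real q + 2 * p) \<in> closure D3" (is "?L \<in> _")
proof -
  obtain s where s: "[6 * p * s = 1] (mod q)"
    using cong_solve_coprime_nat[OF cop] unfolding One_nat_def by blast
  \<comment> \<open>Here \<open>5 * (q - 1)\<close> plays the part of -5 modulo \<open>q\<close>
    within the naturals, and \<open>s\<close> inverts \<open>6 * p\<close>. The summand
    \<open>q * Suc l\<close> moves through the residue class and keeps \<open>t l\<close>
    positive.\<close>
  define t where "t = (\<lambda>l. s * (5 * (q - 1)) + q * Suc l)"
  have t_pos: "t l > 0" for l
    using \<open>q > 0\<close> by (simp add: t_def)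
  have "q dvd 6 * p * t l + 5" for l
  proof -
    have "[6 * p * s * (5 * (q - 1)) + 6 * p * q * Suc l + 5 = 1 * (5 * (q - 1)) + 0 + 5] (mod q)"
      by (intro cong_add cong_mult s cong_refl) (simp add: cong_0_iff)
    moreover have "1 * (5 * (q - 1)) + 0 + 5 = 5 * q"
      using \<open>q > 0\<close> by (simp add: algebra_simps)
    moreover have "6 * p * t l + 5 = 6 * p * s * (5 * (q - 1)) + 6 * p * q * Suc l + 5"
      by (simp only: t_def algebra_simps)
    ultimately have "[6 * p * t l + 5 = 5 * q] (mod q)"
      by simp
    then show ?thesis
      using cong_dvd_iff by fastforce
  qed
  then obtain w where w: "\<And>l. 6 * p * t l + 5 = q * w l"
    unfolding dvd_def by metis
  \<comment> \<open>This is the ratio from \<open>factorization_imp_D3\<close> for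
    \<open>u = t l * q\<close>, \<open>v = p * w l\<close> and \<open>P + 1 = p * t l\<close>, where
    \<open>2 * P + 3 = 2 * p * t l + 1\<close>.\<close>
  define g where "g = (\<lambda>l. real (p * w l + 2 * p * t l + 1) / real (t l * q + 2 * p * t l + 1))"
  have g_eq: "g l = ((6 * real p ^ 2 / q + 2 * p) + (5 * p / q + 1) * inverse (real (t l)))
      / ((real q + 2 * p) + inverse (real (t l)))" for l
  proof -
    have "real q * real (w l) = 6 * p * t l + 5"
      using w[of l] by (metis of_nat_mult)
    then have w_eq: "real (w l) = (6 * p * t l + 5) / q"
      using \<open>q > 0\<close> by (simp add: field_simps)
    have *: "real (p * w l + 2 * p * t l + 1) =
        real (t l) * ((6 * real p ^ 2 / q + 2 * p) + (5 * p / q + 1) * inverse (real (t l)))"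
      unfolding of_nat_add of_nat_mult w_eq
      using t_pos[of l] \<open>q > 0\<close> by (simp add: field_simps power2_eq_square)
    have **: "real (t l * q + 2 * p * t l + 1) =
        real (t l) * ((real q + 2 * p) + inverse (real (t l)))"
      using t_pos[of l] by (simp add: field_simps)
    show ?thesis
      unfolding g_def * ** using t_pos[of l] by simp
  qed
  have "strict_mono t"
    using \<open>q > 0\<close> by (auto simp: strict_mono_Suc_iff t_def)
  then have inv0: "(\<lambda>l. inverse (real (t l))) \<longlonglongrightarrow> 0"
    by (intro tendsto_inverse_0_at_top filterlim_compose[OF filterlim_real_sequentially]
        filterlim_subseq)
  have "g \<longlonglongrightarrow> ((6 * real p ^ 2 / q + 2 * p) + (5 * p / q + 1) * 0) / ((real q + 2 * p) + 0)"
    unfolding g_eq using \<open>q > 0\<close> by (intro tendsto_intros inv0) auto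
  then have lim: "g \<longlonglongrightarrow> ?L"
    by simp
  \<comment> \<open>The bound \<open>g l > 1\<close> orders the two factors; by \<open>gt1\<close>
    it holds for all large \<open>l\<close>.\<close>
  have "g l \<in> D3" if "g l > 1" for l
  proof -
    obtain P where P: "p * t l = P + 1"
      using \<open>p > 0\<close> t_pos[of l] by (metis Suc_eq_plus1 gr0_implies_Suc nat_0_less_mult_iff)
    have "(t l * q) * (p * w l) = (p * t l) * (q * w l)"
      by simp
    also have "\<dots> = (p * t l) * (6 * (p * t l) + 5)"
      by (simp add: w[symmetric] mult.assoc)
    also have "\<dots> = (P + 1) * (6 * P + 11)"
      by (simp add: P)
    finally have "(t l * q) * (p * w l) = (P + 1) * (6 * P + 11)" .
    moreover have "real (t l * q + 2 * p * t l + 1) < real (p * w l + 2 * p * t l + 1)"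
      using that unfolding g_def
      by (subst (asm) less_divide_eq_1_pos) (simp_all del: of_nat_add of_nat_mult)
    then have "t l * q \<le> p * w l"
      unfolding of_nat_less_iff by simp
    ultimately have "real (p * w l + 2 * P + 3) / real (t l * q + 2 * P + 3) \<in> D3"
      by (rule factorization_imp_D3)
    moreover have "2 * p * t l + 1 = 2 * P + 3"
      using P by (simp add: mult.assoc)
    ultimately show ?thesis
      by (simp only: g_def add.assoc)
  qed
  then have "\<forall>\<^sub>F l in sequentially. g l \<in> closure D3"
    using order_tendstoD(1)[OF lim gt1] closure_subset by (auto elim!: eventually_mono)
  then show ?thesis
    using lim by (intro Lim_in_closed_set[OF closed_closure]) auto
qed

text \<open>A second limit, over \<open>k\<close>, is taken among the limits already found; it stays
  in \<open>closure D3\<close> because that set is closed.\<close>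

lemma Ioi_subset_closure_D3: "{1<..} \<subseteq> closure D3"
proof
  fix r :: real
  assume "r \<in> {1<..}"
  then have "r > 1" by simp
  define f where "f = (\<lambda>\<beta>::real. (6 / \<beta> + 2) / (\<beta> + 2))"
  obtain \<beta> where \<beta>: "\<beta> > 0" "f \<beta> = r"
  proof
    \<comment> \<open>Clearing denominators in \<open>f \<beta> = r\<close> gives
      \<open>r * \<beta>\<^sup>2 + 2 * (r - 1) * \<beta> - 6 = 0\<close>; its positive root is
      chosen, and \<open>d\<^sup>2\<close> is a quarter of the discriminant.\<close>
    define d where "d = sqrt ((r - 1)\<^sup>2 + 6 * r)"
    define \<beta> where "\<beta> = (d - (r - 1)) / r"
    have d: "d\<^sup>2 = (r - 1)\<^sup>2 + 6 * r"
      using \<open>r > 1\<close> by (simp add: d_def)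
    have "d > r - 1"
      unfolding d_def using \<open>r > 1\<close> by (intro real_less_rsqrt) simp
    then show "\<beta> > 0"
      using \<open>r > 1\<close> by (simp add: \<beta>_def)
    have "r * \<beta> = d - (r - 1)"
      using \<open>r > 1\<close> by (simp add: \<beta>_def)
    then have "(r * \<beta> + (r - 1))\<^sup>2 = (r - 1)\<^sup>2 + 6 * r"
      using d by simp
    then have "r * (r * \<beta>\<^sup>2 + 2 * r * \<beta>) = r * (6 + 2 * \<beta>)"
      by (simp add: power2_eq_square algebra_simps)
    then have "r * \<beta>\<^sup>2 + 2 * r * \<beta> = 6 + 2 * \<beta>"
      using \<open>r > 1\<close> by simp
    then show "f \<beta> = r"
      using \<open>\<beta> > 0\<close> by (simp add: f_def divide_simps power2_eq_square) (simp add: algebra_simps)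
  qed
  \<comment> \<open>Rounding \<open>\<beta> * 6 ^ k\<close> to a number congruent to 1 modulo 6
    costs at most 6 and makes it coprime to \<open>6 * 6 ^ k\<close>.\<close>
  define q where "q = (\<lambda>k::nat. 6 * nat \<lfloor>\<beta> * 6 ^ k / 6\<rfloor> + 1)"
  have approx: "\<bar>real (q k) / 6 ^ k - \<beta>\<bar> \<le> 6 * (1 / 6) ^ k" for k
  proof -
    have "\<beta> * 6 ^ k / 6 \<ge> 0"
      using \<beta> by simp
    then have "real (q k) = 6 * of_int \<lfloor>\<beta> * 6 ^ k / 6\<rfloor> + 1"
      by (simp add: q_def)
    then have "\<bar>real (q k) - \<beta> * 6 ^ k\<bar> \<le> 6"
      by linarith
    then have "\<bar>real (q k) - \<beta> * 6 ^ k\<bar> / 6 ^ k \<le> 6 / 6 ^ k"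
      by (simp add: divide_right_mono)
    moreover have "\<bar>real (q k) - \<beta> * 6 ^ k\<bar> / 6 ^ k = \<bar>real (q k) / 6 ^ k - \<beta>\<bar>"
      by (subst abs_div_pos) (simp_all add: diff_divide_distrib)
    ultimately show ?thesis
      by (simp add: power_one_over)
  qed
  have "(\<lambda>k. 6 * (1 / 6 :: real) ^ k) \<longlonglongrightarrow> 6 * 0"
    by (intro tendsto_intros LIMSEQ_power_zero) auto
  then have bound_lim: "(\<lambda>k. 6 * (1 / 6 :: real) ^ k) \<longlonglongrightarrow> 0"
    by simp
  have "(\<lambda>k. real (q k) / 6 ^ k - \<beta>) \<longlonglongrightarrow> 0"
    by (rule Lim_null_comparison[OF _ bound_lim]) (simp add: approx)
  then have q_lim: "(\<lambda>k. real (q k) / 6 ^ k) \<longlonglongrightarrow> \<beta>"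
    by (simp add: LIM_zero_iff)
  have lim: "(\<lambda>k. f (real (q k) / 6 ^ k)) \<longlonglongrightarrow> r"
    unfolding \<beta>(2)[symmetric] f_def using \<beta>(1) by (intro tendsto_intros q_lim) auto
  have "f (real (q k) / 6 ^ k) \<in> closure D3" if "f (real (q k) / 6 ^ k) > 1" for k
  proof -
    have "q k > 0"
      by (simp add: q_def)
    have "coprime 6 (q k)"
      using coprime_add_one_right[of "6 * nat \<lfloor>\<beta> * 6 ^ k / 6\<rfloor>"]
      unfolding q_def coprime_mult_left_iff by blast
    then have cop: "coprime (6 * 6 ^ k) (q k)"
      by simp
    have "f (real (q k) / 6 ^ k) =
      (6 * real (6 ^ k) ^ 2 / q k + 2 * real (6 ^ k)) / (real (q k) + 2 * real (6 ^ k))"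
    proof -
      define p where "p = (6::real) ^ k"
      have "p > 0" "real (6 ^ k) = p"
        by (simp_all add: p_def)
      then show ?thesis
        unfolding f_def p_def[symmetric] using \<open>q k > 0\<close>
        by (simp add: divide_simps power2_eq_square) (simp add: algebra_simps)
    qed
    then show ?thesis
      using limit_ratio_in_closure_D3[OF _ \<open>q k > 0\<close> cop] that by simp
  qed
  then have "\<forall>\<^sub>F k in sequentially. f (real (q k) / 6 ^ k) \<in> closure D3"
    using order_tendstoD(1)[OF lim \<open>r > 1\<close>] by (auto elim!: eventually_mono)
  then show "r \<in> closure D3"
    using lim by (intro Lim_in_closed_set[OF closed_closure]) auto
qed

lemma D_subset: "D \<subseteq> {1..}"
proof
  fix z assume "z \<in> D"
  then obtain x n where z: "z = real (x n) / real (x (n - 1))" and n: "3 \<le> n" and x: "x \<in> S n"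
    unfolding D_def by blast
  have "x (n - 1) \<in> {1..}"
    using x n by (intro PiE_mem[of x "{1..n}" "\<lambda>_. {1..}"]) (auto simp: S_def)
  moreover have "x (n - 1) \<le> x n"
    using x n by (intro mono_onD[of "{1..n}" x]) (auto simp: S_def)
  ultimately show "z \<in> {1..}"
    by (simp add: z)
qed

theorem theorem3p5:
  shows "dense_in D3 {1..} \<and> dense_in D {1..}"
proof -
  have "D3 \<subseteq> D"
    unfolding D3_def D_def S3_def by blast
  \<comment> \<open>The endpoint 1 is recovered as a limit point of the open ray.\<close>
  moreover have "closure {1<..} \<subseteq> closure D3"
    using Ioi_subset_closure_D3 by (intro closure_minimal closed_closure)
  then have "{1..} \<subseteq> closure D3"
    by simp
  ultimately show ?thesis
    using D_subset closure_mono[of D3 D] by (auto simp: dense_in_def)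
qed

end
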